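(* Every group $G$ containing a nonabelian free subgroup has infinite collision rank, i.e. $\operatorname{cr}(G)=\infty$.
   Context: Collision rank. Let $G$ be a group. A label set in $G$ is a finite symmetric ($A=A^{-1}$) subset $A\subseteq G$ containing $1$. For $h\ge 1$ let $T_h$ be the complete rooted trivalent tree of height $h$: the root has three children, every other non-leaf vertex has two children, and all leaves are at distance $h$ from the root (so there are $3\cdot 2^{h-1}$ leaves). Two vertices are incomparable if neither lies on the geodesic path from the root to the other. For an edge labeling of $T_h$ by elements of $G$ and a vertex $v$, put $p(v)=a_k\cdots a_1\in G$, where $a_1,\dots,a_k$ are the ordered edge labels along the path from the root to $v$ (and $p(\text{root})=1$). For label sets $A,B\subseteq G$ write $A\Longrightarrow B$ if there is an integer $h\ge 1$ such that for every edge labeling of $T_h$ by elements of $A$ there exist two incomparable vertices $v,w$ with $p(v)\,p(w)^{-1}\in B$. The collision rank $\operatorname{cr}(G)$ is the least integer $r\ge 0$ such that every label set $A_0\subseteq G$ admits label sets $A_1,\dots,A_r\subseteq G$ with $A_0\Longrightarrow A_1\Longrightarrow\cdots\Longrightarrow A_r=\{1\}$ (for $r=0$ this means $A_0=\{1\}$); if no such $r$ exists, $\operatorname{cr}(G)=\infty$. *)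

theory Defs
  imports "HOL-Algebra.Coset" "HOL-Library.Sublist" "HOL-Library.Extended_Nat"
begin

section \<open>Free groups\<close>

text \<open>
  A word over \<open>X\<close> is a list of signed letters: \<open>(x, True)\<close> stands for \<open>x\<close> and \<open>(x, False)\<close> for its
  formal inverse. A word is reduced if no letter is adjacent to its formal inverse. The reduced words
  are the elements of the free group on \<open>X\<close>.
\<close>

definition reduced_words :: "'a set \<Rightarrow> ('a \<times> bool) list set" where
  "reduced_words X =
     {w \<in> lists (X \<times> UNIV). successively (\<lambda>u v. \<not> (fst u = fst v \<and> snd u \<noteq> snd v)) w}"

definition word_value :: "('a, 'b) monoid_scheme \<Rightarrow> ('a \<times> bool) list \<Rightarrow> 'a" where
  "word_value F w =
     foldr (\<lambda>(x, s) g. (if s then x else inv\<^bsub>F\<^esub> x) \<otimes>\<^bsub>F\<^esub> g) w \<one>\<^bsub>F\<^esub>"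

text \<open>
  \<open>X\<close> is a basis of \<open>F\<close> if every element of \<open>F\<close> is the value of exactly one reduced word over \<open>X\<close>,
  that is, if the canonical map from the free group on \<open>X\<close> to \<open>F\<close> is bijective. The empty basis
  is allowed (trivial group), and \<open>X\<close> may be infinite.
\<close>

definition free_basis :: "('a, 'b) monoid_scheme \<Rightarrow> 'a set \<Rightarrow> bool" where
  "free_basis F X \<longleftrightarrow>
     X \<subseteq> carrier F \<and> bij_betw (word_value F) (reduced_words X) (carrier F)"

definition free_group :: "('a, 'b) monoid_scheme \<Rightarrow> bool" where
  "free_group F \<longleftrightarrow> group F \<and> (\<exists>X. free_basis F X)"

definition contains_nonabelian_free_subgroup :: "('a, 'b) monoid_scheme \<Rightarrow> bool" where
  "contains_nonabelian_free_subgroup G \<longleftrightarrow>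
     (\<exists>H. subgroup H G \<and> free_group (G\<lparr>carrier := H\<rparr>) \<and> \<not> comm_group (G\<lparr>carrier := H\<rparr>))"


section \<open>Collision rank\<close>

definition label_set :: "('a, 'b) monoid_scheme \<Rightarrow> 'a set \<Rightarrow> bool" where
  "label_set G A \<longleftrightarrow>
     A \<subseteq> carrier G \<and> finite A \<and> set_inv\<^bsub>G\<^esub> A = A \<and> \<one>\<^bsub>G\<^esub> \<in> A"

text \<open>
  A vertex of the complete rooted trivalent tree of height \<open>h\<close> is encoded by the list of branch
  choices leading to it from the root \<open>[]\<close>: three choices at the root, two at every later step. The
  vertices on the geodesic from the root to \<open>v\<close> are the prefixes of \<open>v\<close>, so two vertices are
  incomparable iff they are \<open>\<parallel>\<close>-related.
\<close>

definition tree_vertices :: "nat \<Rightarrow> nat list set" where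
  "tree_vertices h =
     {v. length v \<le> h \<and> (\<forall>i<length v. v ! i < (if i = 0 then 3 else 2))}"

text \<open>
  Each edge is identified with its endpoint farther from the root, so an edge labeling of the tree is
  a function on the non-root vertices. Values elsewhere are irrelevant.
\<close>

definition edge_labelings :: "nat \<Rightarrow> 'a set \<Rightarrow> (nat list \<Rightarrow> 'a) set" where
  "edge_labelings h A = (tree_vertices h - {[]}) \<rightarrow> A"

text \<open>
  The edges on the path from the root to \<open>v\<close> are the \<open>take i v\<close> for \<open>i = 1, \<dots>, length v\<close>, in this
  order; their labels are multiplied from right to left.
\<close>

definition path_product ::
    "('a, 'b) monoid_scheme \<Rightarrow> (nat list \<Rightarrow> 'a) \<Rightarrow> nat list \<Rightarrow> 'a" where
  "path_product G l v =
     foldl (\<lambda>g i. l (take i v) \<otimes>\<^bsub>G\<^esub> g) \<one>\<^bsub>G\<^esub> [1..<Suc (length v)]"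

lemma path_product_Nil [simp]: "path_product G l [] = \<one>\<^bsub>G\<^esub>"
  by (simp add: path_product_def)

lemma path_product_snoc:
  "path_product G l (v @ [c]) = l (v @ [c]) \<otimes>\<^bsub>G\<^esub> path_product G l v"
proof -
  have "foldl (\<lambda>g i. l (take i (v @ [c])) \<otimes>\<^bsub>G\<^esub> g) \<one>\<^bsub>G\<^esub> [1..<Suc (length v)] =
        foldl (\<lambda>g i. l (take i v) \<otimes>\<^bsub>G\<^esub> g) \<one>\<^bsub>G\<^esub> [1..<Suc (length v)]"
    by (rule foldl_cong) auto
  then show ?thesis
    by (simp add: path_product_def)
qed

definition collides :: "('a, 'b) monoid_scheme \<Rightarrow> 'a set \<Rightarrow> 'a set \<Rightarrow> bool" where
  "collides G A B \<longleftrightarrow>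
     (\<exists>h\<ge>1. \<forall>l\<in>edge_labelings h A. \<exists>v\<in>tree_vertices h. \<exists>w\<in>tree_vertices h.
        v \<parallel> w \<and> path_product G l v \<otimes>\<^bsub>G\<^esub> inv\<^bsub>G\<^esub> (path_product G l w) \<in> B)"

definition collision_chains :: "('a, 'b) monoid_scheme \<Rightarrow> nat \<Rightarrow> bool" where
  "collision_chains G r \<longleftrightarrow>
     (\<forall>A0. label_set G A0 \<longrightarrow>
       (\<exists>A :: nat \<Rightarrow> 'a set. A 0 = A0 \<and> (\<forall>i\<le>r. label_set G (A i)) \<and>
          (\<forall>i<r. collides G (A i) (A (Suc i))) \<and> A r = {\<one>\<^bsub>G\<^esub>}))"

definition collision_rank :: "('a, 'b) monoid_scheme \<Rightarrow> enat" where
  "collision_rank G =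
     (if \<exists>r. collision_chains G r then enat (LEAST r. collision_chains G r) else \<infinity>)"

end

theory Submission
  imports Defs
begin

text \<open>
  Call a family \<open>x\<^sub>0, \<dots>, x\<^bsub>n-1\<^esub>\<close> in \<open>G\<close> alternating-free if no nonempty product of factors
  \<open>x\<^sub>i\<close> and \<open>x\<^sub>i\<close> inverse, in which neighbouring factors have different indices, is trivial.

  The key step (\<open>collides_alternating_free\<close>): if \<open>A\<close> contains an alternating-free family of size
  \<open>3 n\<close> and \<open>A \<Longrightarrow> B\<close>, then \<open>B\<close> contains one of size \<open>n\<close>. Split the indices into \<open>n\<close> blocks of
  three. The non-root vertices of the trivalent tree can be coloured with three colours such that
  siblings have different colours and so do a vertex and its parent. Label every edge by the element
  of the \<open>i\<close>-th block that belongs to the colour of its lower endpoint. For incomparable \<open>v\<close> and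
  \<open>w\<close>, the element \<open>p(v) p(w)\<^sup>-\<^sup>1\<close> reads the labels along the geodesic from \<open>v\<close> to \<open>w\<close>, inverted on
  the way down to \<open>w\<close>, so it is the value of a nonempty alternating word in the \<open>i\<close>-th block. A collision puts such an element
  \<open>y\<^sub>i\<close> into \<open>B\<close>, for each \<open>i\<close>. An alternating word in the \<open>y\<^sub>i\<close> expands to an alternating word in
  the \<open>x\<^sub>j\<close>, because different blocks are disjoint.

  If \<open>a\<close> and \<open>b\<close> are distinct elements of a basis of a free subgroup, then the conjugates
  \<open>a\<^sup>i b a\<^sup>-\<^sup>i\<close> form arbitrarily large alternating-free families (\<open>alternating_free_conjugates\<close>). For
  given \<open>r\<close>, let \<open>A\<^sub>0\<close> contain such a family of size \<open>3\<^sup>r\<close>. At the end of a chain of length \<open>r\<close>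
  there remains a family of size one, that is, a nontrivial element, which contradicts
  \<open>A\<^sub>r = {1}\<close>.
\<close>

section \<open>Values of words\<close>

text \<open>The formal inverse: the letters in reverse order, each with its sign flipped.\<close>

definition inverse_word :: "('i \<times> bool) list \<Rightarrow> ('i \<times> bool) list" where
  "inverse_word w = rev (map (apsnd Not) w)"

lemma word_value_Nil [simp]: "word_value G [] = \<one>\<^bsub>G\<^esub>"
  by (simp add: word_value_def)

lemma word_value_Cons:
  "word_value G ((x, s) # w) = (if s then x else inv\<^bsub>G\<^esub> x) \<otimes>\<^bsub>G\<^esub> word_value G w"
  by (simp add: word_value_def)

lemma inverse_word_Cons: "inverse_word (u # w) = inverse_word w @ [apsnd Not u]"
  by (simp add: inverse_word_def)

lemma inverse_word_eq_Nil_iff [simp]: "inverse_word w = [] \<longleftrightarrow> w = []"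
  by (simp add: inverse_word_def)

lemma fst_set_inverse_word [simp]: "fst ` set (inverse_word w) = fst ` set w"
  by (force simp: inverse_word_def image_image)

lemma map_inverse_word: "map (apfst f) (inverse_word w) = inverse_word (map (apfst f) w)"
  by (simp add: inverse_word_def rev_map comp_def)

lemma (in group) word_value_closed [intro, simp]:
  "fst ` set w \<subseteq> carrier G \<Longrightarrow> word_value G w \<in> carrier G"
  by (induction w) (auto simp: word_value_Cons)

lemma (in group) word_value_append:
  "fst ` set u \<subseteq> carrier G \<Longrightarrow> fst ` set w \<subseteq> carrier G \<Longrightarrow>
     word_value G (u @ w) = word_value G u \<otimes> word_value G w"
  by (induction u) (auto simp: word_value_Cons m_assoc)

lemma (in group) word_value_inverse_word:
  assumes "fst ` set w \<subseteq> carrier G"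
  shows "word_value G (inverse_word w) = inv (word_value G w)"
  using assms
proof (induction w)
  case (Cons u w)
  have "word_value G (inverse_word (u # w)) =
      inv (word_value G w) \<otimes> word_value G [apsnd Not u]"
    using Cons by (subst inverse_word_Cons, subst word_value_append) auto
  also have "\<dots> = inv (word_value G (u # w))"
    using Cons.prems by (cases u) (auto simp: word_value_Cons inv_mult_group)
  finally show ?case .
qed (simp add: inverse_word_def)

lemma (in group) word_value_subgroup:
  assumes "subgroup H G" "fst ` set w \<subseteq> H"
  shows "word_value (G\<lparr>carrier := H\<rparr>) w = word_value G w"
  using assms(2)
  by (induction w) (auto simp: word_value_Cons m_inv_consistent[OF assms(1)])


section \<open>Alternating words\<close>

abbreviation alternating :: "('i \<times> bool) list \<Rightarrow> bool" where
  "alternating \<equiv> successively (\<lambda>u v. fst u \<noteq> fst v)"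

lemma alternating_inverse_word [simp]: "alternating (inverse_word w) \<longleftrightarrow> alternating w"
  by (simp add: inverse_word_def successively_map eq_commute)

text \<open>
  The family \<open>x\<close> indexed by \<open>{..<n}\<close> is alternating-free if every nonempty alternating word in it
  has a nontrivial value. This says nothing about powers of a single \<open>x i\<close>, whose order may be
  finite; for \<open>n = 1\<close> it just means \<open>x 0 \<noteq> 1\<close>.
\<close>

definition alternating_free :: "('a, 'b) monoid_scheme \<Rightarrow> nat \<Rightarrow> (nat \<Rightarrow> 'a) \<Rightarrow> bool" where
  "alternating_free G n x \<longleftrightarrow>
     x ` {..<n} \<subseteq> carrier G \<and>
     (\<forall>w. fst ` set w \<subseteq> {..<n} \<longrightarrow> w \<noteq> [] \<longrightarrow> alternating w \<longrightarrow>
        word_value G (map (apfst x) w) \<noteq> \<one>\<^bsub>G\<^esub>)"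

text \<open>Replace each letter \<open>i\<close> by the word \<open>W i\<close>, and its formal inverse by that of \<open>W i\<close>.\<close>

definition substitute_words :: "('i \<Rightarrow> ('j \<times> bool) list) \<Rightarrow> ('i \<times> bool) list \<Rightarrow> ('j \<times> bool) list" where
  "substitute_words W w = concat (map (\<lambda>(i, s). if s then W i else inverse_word (W i)) w)"

lemma substitute_words_simps [simp]:
  "substitute_words W [] = []"
  "substitute_words W ((i, s) # w) =
     (if s then W i else inverse_word (W i)) @ substitute_words W w"
  by (auto simp: substitute_words_def)

lemma fst_set_substitute_words:
  "fst ` set (substitute_words W w) = (\<Union>i \<in> fst ` set w. fst ` set (W i))"
proof (induction w)
  case (Cons u w)
  then show ?case
    by (cases u) (simp add: image_Un)
qed simp

text \<open>
  Substituting alternating words over pairwise disjoint blocks into an alternating word gives an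
  alternating word: the map \<open>block\<close> tells to which block a letter belongs.
\<close>

lemma alternating_substitute_words:
  assumes W: "\<And>i. i \<in> fst ` set w \<Longrightarrow>
      W i \<noteq> [] \<and> alternating (W i) \<and> (\<forall>j \<in> fst ` set (W i). block j = i)"
    and "alternating w" "w \<noteq> []"
  shows "alternating (substitute_words W w) \<and> substitute_words W w \<noteq> [] \<and>
     block (fst (hd (substitute_words W w))) = fst (hd w)"
  using assms
proof (induction w)
  case (Cons u w)
  obtain i s where u: "u = (i, s)" by (cases u)
  define V where "V = (if s then W i else inverse_word (W i))"
  have V: "V \<noteq> []" "alternating V"
    using Cons.prems(1)[of i] by (auto simp: V_def u)
  have "fst ` set V = fst ` set (W i)"
    by (simp add: V_def)
  then have blk: "\<forall>j \<in> fst ` set V. block j = i"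
    using Cons.prems(1)[of i] by (simp add: u)
  have hdV: "block (fst (hd V)) = i" and lastV: "block (fst (last V)) = i"
    using blk V(1) by auto
  have sub: "substitute_words W (u # w) = V @ substitute_words W w"
    by (simp add: u V_def)
  show ?case
  proof (cases "w = []")
    case True
    then show ?thesis
      unfolding sub using V hdV by (simp add: u)
  next
    case False
    have "alternating w" and "i \<noteq> fst (hd w)"
      using Cons.prems(2) False by (auto simp: u successively_Cons)
    moreover have "alternating (substitute_words W w) \<and> substitute_words W w \<noteq> [] \<and>
        block (fst (hd (substitute_words W w))) = fst (hd w)"
      using Cons.prems(1) False \<open>alternating w\<close> by (intro Cons.IH) auto
    ultimately show ?thesis
      using V hdV lastV unfolding sub by (auto simp: successively_append_iff u)
  qed
qed simp

lemma (in group) word_value_substitute_words: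
  assumes "\<And>i. i \<in> fst ` set w \<Longrightarrow> x ` fst ` set (W i) \<subseteq> carrier G"
  shows "word_value G (map (apfst x) (substitute_words W w)) =
     word_value G (map (apfst (\<lambda>i. word_value G (map (apfst x) (W i)))) w)"
  using assms
proof (induction w)
  case (Cons u w)
  obtain i s where u: "u = (i, s)" by (cases u)
  define V where "V = (if s then W i else inverse_word (W i))"
  have Wi: "fst ` set (map (apfst x) (W i)) \<subseteq> carrier G"
    using Cons.prems[of i] by (simp add: u image_image)
  have "fst ` set V = fst ` set (W i)"
    by (simp add: V_def)
  then have V: "fst ` set (map (apfst x) V) \<subseteq> carrier G"
    using Cons.prems[of i] by (simp add: u image_image[symmetric, of x fst] image_image[of fst "apfst x"])
  have "x ` fst ` set (substitute_words W w) \<subseteq> carrier G"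
    using Cons.prems by (auto simp: fst_set_substitute_words image_UN)
  then have rest: "fst ` set (map (apfst x) (substitute_words W w)) \<subseteq> carrier G"
    by (simp add: image_image)
  have "word_value G (map (apfst x) V) =
      (if s then word_value G (map (apfst x) (W i)) else inv (word_value G (map (apfst x) (W i))))"
    using word_value_inverse_word[OF Wi] by (simp add: V_def map_inverse_word)
  then show ?case
    using Cons word_value_append[OF V rest] by (simp add: u V_def word_value_Cons)
qed simp


section \<open>Colliding pairs in a coloured tree\<close>

text \<open>
  The sum runs over the branch choices plus one. Hence the three children of the root get three
  different colours, and a step from any other vertex adds 1 or 2 modulo 3.
\<close>

definition colour :: "nat list \<Rightarrow> nat" where
  "colour v = sum_list (map Suc v) mod 3"

lemma colour_less: "colour v < 3"
  by (simp add: colour_def)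

lemma colour_siblings:
  assumes "c < 3" "d < 3" "c \<noteq> d"
  shows "colour (v @ [c]) \<noteq> colour (v @ [d])"
proof -
  have "(m + Suc c) mod 3 \<noteq> (m + Suc d) mod 3" for m
    using assms by presburger
  then show ?thesis
    by (simp add: colour_def)
qed

lemma colour_child:
  assumes "c < 2"
  shows "colour (v @ [c]) \<noteq> colour v"
proof -
  have "(m + Suc c) mod 3 \<noteq> m mod 3" for m
    using assms by presburger
  then show ?thesis
    by (simp add: colour_def)
qed

text \<open>The vertices below \<open>z\<close> on the path from \<open>z\<close> to \<open>z @ s\<close>, the deepest one first.\<close>

fun path_below :: "nat list \<Rightarrow> nat list \<Rightarrow> nat list list" where
  "path_below z [] = []"
| "path_below z (c # s) = path_below (z @ [c]) s @ [z @ [c]]"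

lemma (in group) path_product_append:
  assumes "\<And>v. l v \<in> carrier G"
  shows "path_product G l (z @ s) =
    word_value G (map (\<lambda>v. (l v, True)) (path_below z s)) \<otimes> path_product G l z"
proof -
  have closed: "path_product G l v \<in> carrier G" for v
    by (induction v rule: rev_induct) (auto simp: path_product_snoc assms)
  have word_closed: "word_value G (map (\<lambda>v. (l v, True)) vs) \<in> carrier G" for vs
    by (intro word_value_closed) (auto simp: assms)
  show ?thesis
  proof (induction s arbitrary: z)
    case Nil
    show ?case using closed by simp
  next
    case (Cons c s)
    let ?word = "\<lambda>vs. word_value G (map (\<lambda>v. (l v, True)) vs)"
    have "path_product G l (z @ c # s) = path_product G l ((z @ [c]) @ s)"
      by simp
    also have "\<dots> = ?word (path_below (z @ [c]) s) \<otimes> (l (z @ [c]) \<otimes> path_product G l z)"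
      by (subst Cons.IH) (simp add: path_product_snoc)
    also have "\<dots> = (?word (path_below (z @ [c]) s) \<otimes> ?word [z @ [c]]) \<otimes> path_product G l z"
      using closed word_closed assms by (simp add: m_assoc word_value_Cons)
    also have "?word (path_below (z @ [c]) s) \<otimes> ?word [z @ [c]] = ?word (path_below z (c # s))"
      using assms by (simp, subst word_value_append) auto
    finally show ?case .
  qed
qed

lemma colours_path_below:
  "\<forall>d \<in> set (tl s). d < 2 \<Longrightarrow> successively (\<lambda>u v. colour u \<noteq> colour v) (path_below z s)"
proof (induction s arbitrary: z)
  case (Cons c s)
  have "successively (\<lambda>u v. colour u \<noteq> colour v) (path_below (z @ [c]) s)"
    using Cons.prems by (intro Cons.IH) (cases s, auto)
  moreover have "colour (last (path_below (z @ [c]) s)) \<noteq> colour (z @ [c])" if "s \<noteq> []"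
    using that Cons.prems colour_child[of "hd s" "z @ [c]"] by (cases s) auto
  ultimately show ?case
    by (cases "s = []") (auto simp: successively_append_iff)
qed simp

lemma (in group) mult_inv_mult_cancel:
  assumes "a \<in> carrier G" "b \<in> carrier G" "c \<in> carrier G"
  shows "(a \<otimes> c) \<otimes> inv (b \<otimes> c) = a \<otimes> inv b"
proof -
  have "(a \<otimes> c) \<otimes> inv (b \<otimes> c) = a \<otimes> ((c \<otimes> inv c) \<otimes> inv b)"
    using assms by (simp only: inv_mult_group m_assoc inv_closed m_closed)
  then show ?thesis
    using assms by simp
qed

text \<open>
  With labels depending on the colour only, \<open>p(v) p(w)\<^sup>-\<^sup>1\<close> is the value of an alternating word in the
  colours: the word goes up from \<open>v\<close> to the branching point and from there down to \<open>w\<close>, and it is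
  alternating at the branching point since siblings have different colours.
\<close>

lemma (in group) incomparable_quotient_alternating:
  assumes x: "x ` {..<3} \<subseteq> carrier G"
    and "v \<in> tree_vertices h" "w \<in> tree_vertices h" "v \<parallel> w"
  obtains u where "fst ` set u \<subseteq> {..<3}" "u \<noteq> []" "alternating u"
    "path_product G (x \<circ> colour) v \<otimes> inv (path_product G (x \<circ> colour) w) =
       word_value G (map (apfst x) u)"
proof -
  obtain z c s d t where cd: "c \<noteq> d" and v: "v = z @ c # s" and w: "w = z @ d # t"
    using parallel_decomp[OF assms(4)] by blast
  have tree: "c < 3 \<and> (\<forall>e \<in> set s. e < 2)" if "z @ c # s \<in> tree_vertices h" for c s
  proof -
    have less: "(z @ c # s) ! i < (if i = 0 then 3 else 2)" if "i < length (z @ c # s)" for i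
      using that \<open>z @ c # s \<in> tree_vertices h\<close> by (auto simp: tree_vertices_def)
    have "c < 3"
      using less[of "length z"] by (auto split: if_splits)
    moreover have "s ! i < 2" if "i < length s" for i
      using less[of "length z + Suc i"] that by (simp add: nth_append)
    ultimately show ?thesis
      by (auto simp: in_set_conv_nth)
  qed
  define word where "word = map (\<lambda>v. (colour v, True))"
  define p where "p = word (path_below z (c # s))"
  define q where "q = word (path_below z (d # t))"
  have alt: "alternating p" "alternating q"
    using tree[of c s] tree[of d t] assms(2,3) v w
      colours_path_below[of "c # s" z] colours_path_below[of "d # t" z]
    by (auto simp: p_def q_def word_def successively_map simp del: path_below.simps)
  have lasts: "fst (last p) = colour (z @ [c])" "fst (last q) = colour (z @ [d])"
    by (simp_all add: p_def q_def word_def)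
  have ne: "p \<noteq> []" "q \<noteq> []"
    by (simp_all add: p_def q_def word_def)
  have sets: "fst ` set p \<subseteq> {..<3}" "fst ` set q \<subseteq> {..<3}"
    by (auto simp: p_def q_def word_def colour_less)
  have closed: "fst ` set (map (apfst x) r) \<subseteq> carrier G" if "fst ` set r \<subseteq> {..<3}" for r :: "(nat \<times> bool) list"
    using that x by (fastforce simp: image_image)
  have label: "(x \<circ> colour) v \<in> carrier G" for v
    using x colour_less[of v] by auto
  have wd: "map (\<lambda>v. ((x \<circ> colour) v, True)) vs = map (apfst x) (word vs)" for vs
    by (simp add: word_def)
  have pz: "path_product G (x \<circ> colour) z \<in> carrier G"
    by (induction z rule: rev_induct) (use label in \<open>auto simp: path_product_snoc\<close>)
  have "path_product G (x \<circ> colour) v = word_value G (map (apfst x) p) \<otimes> path_product G (x \<circ> colour) z"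
    unfolding v p_def wd[symmetric] by (rule path_product_append[OF label])
  moreover have "path_product G (x \<circ> colour) w = word_value G (map (apfst x) q) \<otimes> path_product G (x \<circ> colour) z"
    unfolding w q_def wd[symmetric] by (rule path_product_append[OF label])
  ultimately have "path_product G (x \<circ> colour) v \<otimes> inv (path_product G (x \<circ> colour) w) =
      word_value G (map (apfst x) p) \<otimes> inv (word_value G (map (apfst x) q))"
    using pz word_value_closed[OF closed[OF sets(1)]] word_value_closed[OF closed[OF sets(2)]]
    by (simp add: mult_inv_mult_cancel)
  also have "\<dots> = word_value G (map (apfst x) (p @ inverse_word q))"
    using closed[OF sets(1)] closed[OF sets(2)] closed[of "inverse_word q"] sets
    by (simp only: map_append word_value_append map_inverse_word word_value_inverse_word
        fst_set_inverse_word)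
  finally have quotient: "path_product G (x \<circ> colour) v \<otimes> inv (path_product G (x \<circ> colour) w) = \<dots>" .
  have "fst (hd (inverse_word q)) = fst (last q)"
    using ne by (simp add: inverse_word_def hd_rev last_map)
  then have "alternating (p @ inverse_word q)"
    using alt lasts cd tree[of c s] tree[of d t] assms(2,3) v w colour_siblings[of c d z]
    by (auto simp: successively_append_iff)
  moreover have "fst ` set (p @ inverse_word q) \<subseteq> {..<3}"
    using sets by (simp add: image_Un)
  ultimately show thesis
    using that quotient ne by blast
qed

lemma (in group) collides_alternating_free:
  assumes x: "alternating_free G (3 * n) x" "x ` {..<3 * n} \<subseteq> A" and "collides G A B"
  obtains y where "alternating_free G n y" "y ` {..<n} \<subseteq> B"
proof -
  obtain h where h: "\<And>l. l \<in> edge_labelings h A \<Longrightarrow> \<exists>v\<in>tree_vertices h. \<exists>w\<in>tree_vertices h.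
      v \<parallel> w \<and> path_product G l v \<otimes> inv (path_product G l w) \<in> B"
    using assms(3) unfolding collides_def by blast
  have xG: "x ` {..<3 * n} \<subseteq> carrier G"
    using x(1) by (simp add: alternating_free_def)
  have "\<exists>u. fst ` set u \<subseteq> {3 * i..<3 * i + 3} \<and> u \<noteq> [] \<and> alternating u \<and>
      word_value G (map (apfst x) u) \<in> B" if "i < n" for i
  proof -
    define xi where "xi k = x (3 * i + k)" for k
    have xi: "xi k \<in> A" "xi k \<in> carrier G" if "k < 3" for k
      using x(2) xG that \<open>i < n\<close> by (auto simp: xi_def subset_iff)
    have "xi \<circ> colour \<in> edge_labelings h A"
      using xi colour_less by (auto simp: edge_labelings_def)
    from h[OF this] obtain v w where vw: "v \<in> tree_vertices h" "w \<in> tree_vertices h" "v \<parallel> w"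
      "path_product G (xi \<circ> colour) v \<otimes> inv (path_product G (xi \<circ> colour) w) \<in> B"
      by blast
    have "xi ` {..<3} \<subseteq> carrier G"
      using xi by auto
    then obtain u where u: "fst ` set u \<subseteq> {..<3}" "u \<noteq> []" "alternating u"
      "word_value G (map (apfst xi) u) \<in> B"
      using incomparable_quotient_alternating[OF _ vw(1-3), of xi] vw(4) by metis
    let ?u = "map (apfst (\<lambda>k. 3 * i + k)) u"
    have "map (apfst x) ?u = map (apfst xi) u"
      by (auto simp: xi_def)
    moreover have "fst ` set ?u \<subseteq> {3 * i..<3 * i + 3}" "?u \<noteq> []" "alternating ?u"
      using u by (auto simp: successively_map)
    ultimately show ?thesis
      using u(4) by metis
  qed
  then obtain W where W: "\<And>i. i < n \<Longrightarrow> fst ` set (W i) \<subseteq> {3 * i..<3 * i + 3} \<and> W i \<noteq> [] \<and>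
      alternating (W i) \<and> word_value G (map (apfst x) (W i)) \<in> B"
    by metis
  have W_less: "fst ` set (W i) \<subseteq> {..<3 * n}" if "i < n" for i
    using W[OF that] that by force
  have W_block: "j div 3 = i" if "i < n" "j \<in> fst ` set (W i)" for i j
  proof -
    have "j \<in> {3 * i..<3 * i + 3}"
      using W[OF that(1)] that(2) by blast
    then show ?thesis
      by auto
  qed
  define y where "y i = word_value G (map (apfst x) (W i))" for i
  have "y i \<in> carrier G" if "i < n" for i
    unfolding y_def using W_less[OF that] xG by (intro word_value_closed) (force simp: image_image)
  moreover have "word_value G (map (apfst y) w) \<noteq> \<one>"
    if w: "fst ` set w \<subseteq> {..<n}" "w \<noteq> []" "alternating w" for w
  proof -
    have "alternating (substitute_words W w) \<and> substitute_words W w \<noteq> [] \<and>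
        fst (hd (substitute_words W w)) div 3 = fst (hd w)"
    proof (rule alternating_substitute_words)
      fix i assume "i \<in> fst ` set w"
      then have "i < n"
        using w(1) by blast
      then show "W i \<noteq> [] \<and> alternating (W i) \<and> (\<forall>j \<in> fst ` set (W i). j div 3 = i)"
        using W W_block by blast
    qed (use w in auto)
    moreover have "fst ` set (substitute_words W w) \<subseteq> {..<3 * n}"
      using w(1) W_less by (auto simp: fst_set_substitute_words)
    ultimately have "word_value G (map (apfst x) (substitute_words W w)) \<noteq> \<one>"
      using x(1) by (simp add: alternating_free_def)
    moreover have "word_value G (map (apfst x) (substitute_words W w)) = word_value G (map (apfst y) w)"
      unfolding y_def using w(1) W_less xG by (intro word_value_substitute_words) blast
    ultimately show ?thesis
      by simp
  qed
  ultimately have "alternating_free G n y"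
    by (auto simp: alternating_free_def)
  moreover have "y ` {..<n} \<subseteq> B"
    using W by (auto simp: y_def)
  ultimately show thesis
    using that by blast
qed


section \<open>Alternating-free families in free groups\<close>

lemma (in group) word_value_int_pow:
  assumes "a \<in> carrier G" "fst ` set w \<subseteq> {a}"
  shows "\<exists>k::int. word_value G w = a [^] k"
  using assms(2)
proof (induction w)
  case Nil
  show ?case by (auto intro!: exI[of _ 0])
next
  case (Cons u w)
  then obtain k :: int where k: "word_value G w = a [^] k" by auto
  obtain s where "u = (a, s)" using Cons.prems by (cases u) auto
  then have "word_value G (u # w) = a [^] (if s then 1 else - 1 :: int) \<otimes> a [^] k"
    using assms(1) k by (simp add: word_value_Cons int_pow_neg)
  then show ?case
    using assms(1) by (metis int_pow_mult)
qed

lemma (in group) nonabelian_free_basis: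
  assumes "free_basis G X" "\<not> comm_group G"
  obtains a b where "a \<in> X" "b \<in> X" "a \<noteq> b"
proof (rule ccontr)
  assume "\<not> thesis"
  then have "\<forall>a\<in>X. \<forall>b\<in>X. a = b"
    using that by blast
  then obtain a where a: "a \<in> carrier G" "X \<subseteq> {a}"
    using assms(1) unfolding free_basis_def by (metis one_closed empty_subsetI subset_iff singletonI equals0I)
  have pow: "\<exists>k::int. g = a [^] k" if g: "g \<in> carrier G" for g
  proof -
    obtain w where w: "w \<in> reduced_words X" "g = word_value G w"
      using assms(1) g by (auto simp: free_basis_def bij_betw_def)
    then have "fst ` set w \<subseteq> {a}"
      using a(2) by (auto simp: reduced_words_def)
    then show ?thesis
      using word_value_int_pow a(1) w(2) by blast
  qed
  have "comm_group G"
  proof (rule group_comm_groupI)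
    fix g g' assume "g \<in> carrier G" "g' \<in> carrier G"
    then show "g \<otimes> g' = g' \<otimes> g"
      using pow a(1) by (metis int_pow_mult add.commute)
  qed
  then show False
    using assms(2) by simp
qed

text \<open>The reduced word for \<open>a\<^sup>k\<close> with an integer exponent; it is empty for \<open>k = 0\<close>.\<close>

definition power_word :: "'a \<Rightarrow> int \<Rightarrow> ('a \<times> bool) list" where
  "power_word a k = replicate (nat \<bar>k\<bar>) (a, k > 0)"

text \<open>
  The product of the conjugates of \<open>b\<close> or its inverse by the powers \<open>a\<^sup>i\<close>, with \<open>i\<close> read off from the
  given word, and multiplied by \<open>a\<^sup>-\<^sup>d\<close> from the left. Neighbouring powers of \<open>a\<close> are merged, so the
  result is reduced if the given word is alternating.
\<close>

fun conjugates_word :: "'a \<Rightarrow> 'a \<Rightarrow> nat \<Rightarrow> (nat \<times> bool) list \<Rightarrow> ('a \<times> bool) list" where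
  "conjugates_word a b d [] = power_word a (- int d)"
| "conjugates_word a b d ((i, s) # w) =
     power_word a (int i - int d) @ (b, s) # conjugates_word a b i w"

lemma hd_power_word_append: "k \<noteq> 0 \<Longrightarrow> fst (hd (power_word a k @ w)) = a"
  by (cases "nat \<bar>k\<bar>") (auto simp: power_word_def)

lemma last_power_word: "k \<noteq> 0 \<Longrightarrow> fst (last (power_word a k)) = a"
  by (simp add: power_word_def)

lemma power_word_eq_Nil_iff: "power_word a k = [] \<longleftrightarrow> k = 0"
  by (simp add: power_word_def)

lemma successively_replicate: "P u u \<Longrightarrow> successively P (replicate n u)"
proof (induction n)
  case (Suc n)
  then show ?case
    by (cases n) auto
qed simp

lemma set_conjugates_word: "fst ` set (conjugates_word a b d w) \<subseteq> {a, b}"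
proof (induction w arbitrary: d)
  case (Cons u w)
  then show ?case
    by (cases u) (auto simp: power_word_def image_Un)
qed (auto simp: power_word_def)

lemma reduced_conjugates_word:
  assumes "a \<in> X" "b \<in> X" "a \<noteq> b" "alternating w"
  shows "conjugates_word a b d w \<in> reduced_words X"
proof -
  let ?P = "\<lambda>u v. \<not> (fst u = fst v \<and> snd u \<noteq> snd v)"
  have "successively ?P (conjugates_word a b d w)"
    using \<open>alternating w\<close>
  proof (induction w arbitrary: d)
    case Nil
    show ?case by (simp add: power_word_def successively_replicate)
  next
    case (Cons u w)
    obtain i s where u: "u = (i, s)" by (cases u)
    have tail: "successively ?P (conjugates_word a b i w)"
      using Cons by (auto simp: successively_Cons)
    have "conjugates_word a b i w = [] \<or> fst (hd (conjugates_word a b i w)) = a"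
    proof (cases w)
      case Nil
      then show ?thesis
        using hd_power_word_append[of "- int i" a "[]"] power_word_eq_Nil_iff[of a "- int i"] by auto
    next
      case (Cons v w')
      \<comment> \<open>The exponent between two letters \<open>b\<close> is nonzero since neighbouring indices differ.\<close>
      have "fst v \<noteq> i"
        using Cons.prems Cons by (auto simp: u)
      then show ?thesis
        using Cons hd_power_word_append[of "int (fst v) - int i" a] by (cases v) auto
    qed
    then have "successively ?P ((b, s) # conjugates_word a b i w)"
      using tail \<open>a \<noteq> b\<close> by (auto simp: successively_Cons)
    moreover have "power_word a (int i - int d) = [] \<or> fst (last (power_word a (int i - int d))) = a"
      using last_power_word power_word_eq_Nil_iff by metis
    ultimately show ?case
      using \<open>a \<noteq> b\<close>
      by (auto simp: u successively_append_iff) (simp_all add: power_word_def successively_replicate)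
  qed
  moreover have "set (conjugates_word a b d w) \<subseteq> X \<times> UNIV"
    using assms(1,2) set_conjugates_word[of a b d w] by fastforce
  ultimately show ?thesis
    by (auto simp: reduced_words_def)
qed

lemma (in group) word_value_power_word:
  assumes "a \<in> carrier G"
  shows "word_value G (power_word a k) = a [^] k"
proof -
  have pos: "word_value G (replicate n (a, True)) = a [^] int n" for n
    unfolding int_pow_int
    by (induction n) (use assms nat_pow_Suc2[of a] in \<open>auto simp: word_value_Cons\<close>)
  have neg: "word_value G (replicate n (a, False)) = a [^] (- int n)" for n
    using word_value_inverse_word[of "replicate n (a, True)"] pos[of n] assms
    by (auto simp: inverse_word_def int_pow_neg)
  show ?thesis
    using pos[of "nat \<bar>k\<bar>"] neg[of "nat \<bar>k\<bar>"] by (cases "k > 0") (simp_all add: power_word_def)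
qed

lemma (in group) word_value_conjugates_word:
  assumes "a \<in> carrier G" "b \<in> carrier G"
  shows "word_value G (conjugates_word a b d w) =
    a [^] (- int d) \<otimes> word_value G (map (apfst (\<lambda>i. a [^] int i \<otimes> b \<otimes> a [^] (- int i))) w)"
    (is "_ = _ \<otimes> ?v w")
proof (induction w arbitrary: d)
  case Nil
  show ?case using assms by (simp add: word_value_power_word)
next
  case (Cons u w)
  obtain i s where u: "u = (i, s)" by (cases u)
  define b' where "b' = (if s then b else inv b)"
  have b': "b' \<in> carrier G" using assms by (simp add: b'_def)
  have v: "?v w \<in> carrier G"
    using assms by (intro word_value_closed) auto
  have conj: "(if s then a [^] int i \<otimes> b \<otimes> a [^] (- int i) else inv (a [^] int i \<otimes> b \<otimes> a [^] (- int i)))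
      = a [^] int i \<otimes> b' \<otimes> a [^] (- int i)"
    using assms by (simp add: b'_def int_pow_neg inv_mult_group m_assoc)
  have cw: "fst ` set (conjugates_word a b i w) \<subseteq> carrier G"
    using assms set_conjugates_word[of a b i w] by auto
  have "word_value G (conjugates_word a b d (u # w)) =
      a [^] (int i - int d) \<otimes> (b' \<otimes> word_value G (conjugates_word a b i w))"
    unfolding u conjugates_word.simps using assms cw
    by (subst word_value_append)
      (auto simp: word_value_power_word word_value_Cons b'_def, auto simp: power_word_def)
  also have "\<dots> = a [^] (int i - int d) \<otimes> (b' \<otimes> (a [^] (- int i) \<otimes> ?v w))"
    using Cons.IH by simp
  also have "a [^] (int i - int d) = a [^] (- int d) \<otimes> a [^] int i"
    using assms by (simp add: int_pow_mult[symmetric])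
  also have "a [^] (- int d) \<otimes> a [^] int i \<otimes> (b' \<otimes> (a [^] (- int i) \<otimes> ?v w)) =
      a [^] (- int d) \<otimes> ((a [^] int i \<otimes> b' \<otimes> a [^] (- int i)) \<otimes> ?v w)"
    using assms b' v by (simp add: m_assoc)
  also have "\<dots> = a [^] (- int d) \<otimes> ?v (u # w)"
    unfolding conj[symmetric] by (simp add: u word_value_Cons)
  finally show ?case .
qed

lemma (in group) alternating_free_conjugates:
  assumes "X \<subseteq> carrier G" and inj: "inj_on (word_value G) (reduced_words X)"
    and ab: "a \<in> X" "b \<in> X" "a \<noteq> b"
  shows "alternating_free G n (\<lambda>i. a [^] int i \<otimes> b \<otimes> a [^] (- int i))"
proof -
  have G: "a \<in> carrier G" "b \<in> carrier G"
    using assms by auto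
  have "word_value G (map (apfst (\<lambda>i. a [^] int i \<otimes> b \<otimes> a [^] (- int i))) w) \<noteq> \<one>"
    if w: "w \<noteq> []" "alternating w" for w
  proof
    assume "word_value G (map (apfst (\<lambda>i. a [^] int i \<otimes> b \<otimes> a [^] (- int i))) w) = \<one>"
    then have "word_value G (conjugates_word a b 0 w) = word_value G []"
      using G by (simp add: word_value_conjugates_word)
    moreover have "[] \<in> reduced_words X"
      by (simp add: reduced_words_def)
    ultimately have "conjugates_word a b 0 w = []"
      using inj reduced_conjugates_word[OF ab w(2)] by (meson inj_onD)
    then show False
      using w(1) by (cases w) auto
  qed
  then show ?thesis
    using G by (auto simp: alternating_free_def)
qed

lemma (in group) alternating_free_exists:
  assumes "contains_nonabelian_free_subgroup G"
  obtains x where "alternating_free G n x"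
proof -
  obtain H X where H: "subgroup H G" "free_basis (G\<lparr>carrier := H\<rparr>) X"
    "\<not> comm_group (G\<lparr>carrier := H\<rparr>)"
    using assms by (auto simp: contains_nonabelian_free_subgroup_def free_group_def)
  obtain a b where ab: "a \<in> X" "b \<in> X" "a \<noteq> b"
    using group.nonabelian_free_basis[OF subgroup_imp_group[OF H(1)] H(2,3)] by blast
  have X: "X \<subseteq> H" "inj_on (word_value (G\<lparr>carrier := H\<rparr>)) (reduced_words X)"
    using H(2) by (auto simp: free_basis_def bij_betw_def)
  have "word_value (G\<lparr>carrier := H\<rparr>) w = word_value G w" if "w \<in> reduced_words X" for w
    using that X(1) by (intro word_value_subgroup[OF H(1)]) (auto simp: reduced_words_def)
  then have "inj_on (word_value G) (reduced_words X)"
    using X(2) by (simp cong: inj_on_cong)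
  moreover have "X \<subseteq> carrier G"
    using X(1) subgroup.subset[OF H(1)] by blast
  ultimately show thesis
    using that alternating_free_conjugates ab by blast
qed


section \<open>Infinite collision rank\<close>

lemma (in group) label_set_superset:
  assumes "finite S" "S \<subseteq> carrier G"
  obtains A where "label_set G A" "S \<subseteq> A"
proof -
  define A where "A = insert \<one> (S \<union> m_inv G ` S)"
  have A: "A \<subseteq> carrier G" "finite A" "\<one> \<in> A"
    using assms by (auto simp: A_def)
  have "inv a \<in> A" if "a \<in> A" for a
    using that assms(2) by (auto simp: A_def)
  then have "set_inv A = A"
    using A(1) by (auto simp: SET_INV_def) (metis inv_inv subset_iff)
  then have "label_set G A"
    using A by (simp add: label_set_def)
  then show thesis
    using that by (auto simp: A_def)
qed

theorem proposition6p4: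
  fixes G :: "('a, 'b) monoid_scheme"
  assumes "group G"
    and "contains_nonabelian_free_subgroup G"
  shows "collision_rank G = \<infinity>"
proof -
  interpret group G by fact
  have "\<not> collision_chains G r" for r
  proof
    assume chains: "collision_chains G r"
    obtain x where x: "alternating_free G (3 ^ r) x"
      using alternating_free_exists[OF assms(2)] .
    then have "x ` {..<3 ^ r} \<subseteq> carrier G"
      by (simp add: alternating_free_def)
    then obtain A0 where A0: "label_set G A0" "x ` {..<3 ^ r} \<subseteq> A0"
      using label_set_superset[of "x ` {..<3 ^ r}"] by blast
    then obtain A where A: "A 0 = A0" "\<And>i. i < r \<Longrightarrow> collides G (A i) (A (Suc i))" "A r = {\<one>\<^bsub>G\<^esub>}"
      using chains unfolding collision_chains_def by meson
    have "\<exists>y. alternating_free G (3 ^ (r - i)) y \<and> y ` {..<3 ^ (r - i)} \<subseteq> A i" if "i \<le> r" for i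
      using that
    proof (induction i)
      case 0
      then show ?case using x A0 A(1) by auto
    next
      case (Suc i)
      then have "(3::nat) ^ (r - i) = 3 * 3 ^ (r - Suc i)"
        by (metis Suc_diff_le Suc_le_lessD diff_Suc_Suc power_Suc)
      then show ?case
        using Suc A(2)[of i] by (metis Suc_leD Suc_le_lessD collides_alternating_free)
    qed
    from this[of r] obtain y where y: "alternating_free G 1 y" "y 0 = \<one>\<^bsub>G\<^esub>"
      using A(3) by auto
    from y(1) have "word_value G (map (apfst y) [(0, True)]) \<noteq> \<one>\<^bsub>G\<^esub>"
      unfolding alternating_free_def by (auto dest: spec[of _ "[(0, True)]"])
    then show False
      using y(2) by (simp add: word_value_Cons)
  qed
  then show ?thesis
    by (simp add: collision_rank_def)
qed

end
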